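(* $\mathrm{NON}\equiv_{\mathrm{sW}}\Pi(\mathrm{DIS})$, i.e., the non-computability problem is strongly Weihrauch equivalent to the parallelization of the discontinuity problem.
   Context: A represented space is a set $X$ with a partial surjective map $\delta_X:\subseteq\mathbb N^{\mathbb N}\to X$. A problem is a partial multi-valued function $f:\subseteq X\rightrightarrows Y$ between represented spaces that has a realizer; a realizer of $f$ is a function $F:\subseteq\mathbb N^{\mathbb N}\to\mathbb N^{\mathbb N}$ with $\delta_YF(p)\in f\delta_X(p)$ for all $p\in\mathrm{dom}(f\delta_X)$. For problems $f,g$: $f\leq_{\mathrm{sW}}g$ if there are computable $H,K:\subseteq\mathbb N^{\mathbb N}\to\mathbb N^{\mathbb N}$ such that $HGK$ is a realizer of $f$ whenever $G$ is a realizer of $g$; $f\equiv_{\mathrm{sW}}g$ means $f\leq_{\mathrm{sW}}g$ and $g\leq_{\mathrm{sW}}f$. $\mathbb N^{\mathbb N}$ is represented by the identity. The space $X^{\mathbb N}$ is represented by $\langle p_0,p_1,\dots\rangle\mapsto(\delta_X(p_n))_n$, where $\langle p_0,p_1,\dots\rangle\langle n,k\rangle:=p_n(k)$ and $\langle n,k\rangle:=\frac12(n+k)(n+k+1)+k$ for $n,k\in\mathbb N$. Parallelization: for $f:\subseteq X\rightrightarrows Y$, $\Pi f:\subseteq X^{\mathbb N}\rightrightarrows Y^{\mathbb N}$ (also written $\widehat f$) has $\mathrm{dom}(\Pi f)=\mathrm{dom}(f)^{\mathbb N}$ and $\Pi f((x_n)_n)=\{(y_n)_n:(\forall n)\ y_n\in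 f(x_n)\}$. $\varphi^p$ is a standard Gödel numbering of the partial functions $\varphi^p_i:\subseteq\mathbb N\to\mathbb N$ computable relative to the oracle $p$. $\langle p,q\rangle(2n)=p(n)$, $\langle p,q\rangle(2n+1)=q(n)$ for $p,q\in\mathbb N^{\mathbb N}$; $\langle i,r\rangle:=ir$ (concatenation) for $i\in\mathbb N$, $r\in\mathbb N^{\mathbb N}$. The universal function $\mathrm U:\subseteq\mathbb N^{\mathbb N}\to\mathbb N^{\mathbb N}$ is $\mathrm U\langle\langle i,r\rangle,p\rangle:=\varphi_i^{\langle r,p\rangle}$ if $\varphi_i^{\langle r,p\rangle}$ is total, and undefined otherwise. $\mathrm{DIS}:\mathbb N^{\mathbb N}\rightrightarrows\mathbb N^{\mathbb N}$, $p\mapsto\{q:\mathrm U(p)\neq q\}$ (every $q$ is a solution if $\mathrm U(p)$ is undefined). $\mathrm{NON}:\mathbb N^{\mathbb N}\rightrightarrows\mathbb N^{\mathbb N}$, $p\mapsto\{q:q\not\leq_{\mathrm T}p\}$, where $\leq_{\mathrm T}$ is Turing reducibility. *)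

theory Defs
  imports Main "HOL-Library.Nat_Bijection"
begin

type_synonym baire = "nat \<Rightarrow> nat"


section \<open>Pairings on numbers and on Baire space\<close>

definition pair :: "nat \<Rightarrow> nat \<Rightarrow> nat" where
  "pair n k = (n + k) * (n + k + 1) div 2 + k"

lemma pair_conv_prod_encode: "pair n k = prod_encode (k, n)"
  by (simp add: pair_def prod_encode_def triangle_def add.commute)

lemma bij_pair: "bij (\<lambda>(n, k). pair n k)"
proof -
  have "(\<lambda>(n, k). pair n k) = prod_encode \<circ> prod.swap"
    by (auto simp: pair_conv_prod_encode)
  then show ?thesis
    by (simp add: bij_comp bij_prod_encode)
qed

definition unpair :: "nat \<Rightarrow> nat \<times> nat" where
  "unpair = inv (\<lambda>(n, k). pair n k)"

lemma unpair_pair [simp]: "unpair (pair n k) = (n, k)"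
  using inv_f_f[OF bij_is_inj[OF bij_pair], of "(n, k)"] by (simp add: unpair_def)

lemma pair_unpair [simp]: "pair (fst (unpair m)) (snd (unpair m)) = m"
  using surj_f_inv_f[OF bij_is_surj[OF bij_pair], of m]
  by (simp add: unpair_def case_prod_beta)

lemma pair_inject [simp]: "pair a b = pair c d \<longleftrightarrow> a = c \<and> b = d"
  by (auto simp: pair_conv_prod_encode)

lemma le_pair_left: "n \<le> pair n k"
  by (simp add: pair_conv_prod_encode le_prod_encode_2)

lemma le_pair_right: "k \<le> pair n k"
  by (simp add: pair_conv_prod_encode le_prod_encode_1)

definition join :: "baire \<Rightarrow> baire \<Rightarrow> baire" where
  "join p q m = (if even m then p (m div 2) else q (m div 2))"

lemma join_even [simp]: "join p q (2 * n) = p n"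
  and join_odd [simp]: "join p q (2 * n + 1) = q n"
  by (simp_all add: join_def)

definition evens :: "baire \<Rightarrow> baire" where
  "evens p n = p (2 * n)"

definition odds :: "baire \<Rightarrow> baire" where
  "odds p n = p (2 * n + 1)"

lemma evens_join [simp]: "evens (join p q) = p"
  and odds_join [simp]: "odds (join p q) = q"
  by (simp_all add: evens_def odds_def join_def fun_eq_iff)

lemma join_evens_odds [simp]: "join (evens p) (odds p) = p"
  by (auto simp: evens_def odds_def join_def fun_eq_iff elim: oddE)

definition prepend :: "nat \<Rightarrow> baire \<Rightarrow> baire" where
  "prepend i r = case_nat i r"

lemma prepend_0 [simp]: "prepend i r 0 = i"
  and prepend_Suc [simp]: "prepend i r (Suc n) = r n"
  by (simp_all add: prepend_def)

definition tuple :: "(nat \<Rightarrow> baire) \<Rightarrow> baire" where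
  "tuple P m = P (fst (unpair m)) (snd (unpair m))"

definition component :: "baire \<Rightarrow> nat \<Rightarrow> baire" where
  "component p n k = p (pair n k)"

lemma tuple_pair: "tuple P (pair n k) = P n k"
  by (simp add: tuple_def)

lemma component_tuple [simp]: "component (tuple P) = P"
  by (simp add: component_def tuple_def fun_eq_iff)

lemma tuple_component [simp]: "tuple (component p) = p"
  by (simp add: component_def tuple_def fun_eq_iff)


section \<open>Computability relative to an oracle\<close>

text \<open>Programs for partial recursive functions in one argument, with an oracle. Several
  arguments are passed through the pairing function, so no projections besides the two inverses
  of the pairing are needed. \<open>RecP\<close> recurses on the second component of its argument, and
  \<open>MinP\<close> is unbounded search, which requires all smaller values to be defined.\<close>

datatype prog =
    ZeroP
  | SuccP
  | LeftP
  | RightP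
  | OracleP
  | PairP prog prog
  | CompP prog prog
  | RecP prog prog
  | MinP prog

definition minimize :: "(nat \<Rightarrow> nat option) \<Rightarrow> nat option" where
  "minimize h =
     (if \<exists>n. h n = Some 0 \<and> (\<forall>m<n. h m \<noteq> None) then Some (LEAST n. h n = Some 0) else None)"

primrec eval :: "baire \<Rightarrow> prog \<Rightarrow> nat \<Rightarrow> nat option" where
  "eval p ZeroP = (\<lambda>x. Some 0)"
| "eval p SuccP = (\<lambda>x. Some (Suc x))"
| "eval p LeftP = (\<lambda>x. Some (fst (unpair x)))"
| "eval p RightP = (\<lambda>x. Some (snd (unpair x)))"
| "eval p OracleP = (\<lambda>x. Some (p x))"
| "eval p (PairP c d) =
     (\<lambda>x. Option.bind (eval p c x) (\<lambda>a. Option.bind (eval p d x) (\<lambda>b. Some (pair a b))))"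
| "eval p (CompP c d) = (\<lambda>x. Option.bind (eval p d x) (eval p c))"
| "eval p (RecP c d) =
     (\<lambda>x. rec_nat (eval p c (fst (unpair x)))
            (\<lambda>n r. Option.bind r (\<lambda>v. eval p d (pair (fst (unpair x)) (pair n v))))
            (snd (unpair x)))"
| "eval p (MinP c) = (\<lambda>x. minimize (\<lambda>n. eval p c (pair x n)))"

text \<open>This numbering is bijective, and it and its inverse are effective on program syntax, so
  \<open>phi\<close> below is a standard numbering.\<close>

primrec godel :: "prog \<Rightarrow> nat" where
  "godel ZeroP = 0"
| "godel SuccP = 1"
| "godel LeftP = 2"
| "godel RightP = 3"
| "godel OracleP = 4"
| "godel (PairP c d) = 5 + 4 * pair (godel c) (godel d)"
| "godel (CompP c d) = 6 + 4 * pair (godel c) (godel d)"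
| "godel (RecP c d) = 7 + 4 * pair (godel c) (godel d)"
| "godel (MinP c) = 8 + 4 * godel c"

lemma inj_godel: "inj godel"
proof (rule injI)
  show "c = d" if "godel c = godel d" for c d
    using that
  proof (induction c arbitrary: d)
    case ZeroP then show ?case by (cases d) auto
  next
    case SuccP then show ?case by (cases d) auto
  next
    case LeftP then show ?case by (cases d) auto
  next
    case RightP then show ?case by (cases d) auto
  next
    case OracleP then show ?case by (cases d) auto
  next
    case (PairP c1 c2) then show ?case by (cases d) (auto, presburger+)
  next
    case (CompP c1 c2) then show ?case by (cases d) (auto, presburger+)
  next
    case (RecP c1 c2) then show ?case by (cases d) (auto, presburger+)
  next
    case (MinP c) then show ?case by (cases d) (auto, presburger+)
  qed
qed

lemma surj_godel: "surj godel"
proof -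
  have "\<exists>c. godel c = n" for n
  proof (induction n rule: less_induct)
    case (less n)
    show ?case
    proof (cases "n < 5")
      case True
      then have "n = 0 \<or> n = 1 \<or> n = 2 \<or> n = 3 \<or> n = 4" by auto
      then show ?thesis using godel.simps(1-5) by metis
    next
      case False
      define k where "k = (n - 5) div 4"
      have k: "n = 5 + 4 * k \<or> n = 6 + 4 * k \<or> n = 7 + 4 * k \<or> n = 8 + 4 * k"
        using False unfolding k_def by presburger
      then have "k < n" by auto
      moreover have "fst (unpair k) \<le> k" "snd (unpair k) \<le> k"
        using le_pair_left[of "fst (unpair k)" "snd (unpair k)"]
          le_pair_right[of "snd (unpair k)" "fst (unpair k)"] by simp_all
      ultimately obtain a b c
        where "godel a = fst (unpair k)" "godel b = snd (unpair k)" "godel c = k"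
        using less.IH by (metis le_less_trans)
      then have "godel (PairP a b) = 5 + 4 * k" "godel (CompP a b) = 6 + 4 * k"
        "godel (RecP a b) = 7 + 4 * k" "godel (MinP c) = 8 + 4 * k"
        by simp_all
      then show ?thesis using k by metis
    qed
  qed
  then show ?thesis by (metis surj_def)
qed

definition phi :: "baire \<Rightarrow> nat \<Rightarrow> nat \<Rightarrow> nat option" where
  "phi p i = eval p (inv godel i)"

lemma phi_godel [simp]: "phi p (godel c) = eval p c"
  by (simp add: phi_def inv_f_f[OF inj_godel])

definition turing_le :: "baire \<Rightarrow> baire \<Rightarrow> bool"  (infix \<open>\<le>\<^sub>T\<close> 50) where
  "q \<le>\<^sub>T p \<longleftrightarrow> (\<exists>i. \<forall>n. phi p i n = Some (q n))"

text \<open>As usual for partial functions on Baire space, nothing is required of the program on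
  oracles outside the domain of \<open>F\<close>.\<close>

definition computable :: "(baire \<Rightarrow> baire option) \<Rightarrow> bool" where
  "computable F \<longleftrightarrow> (\<exists>i. \<forall>p q. F p = Some q \<longrightarrow> (\<forall>n. phi p i n = Some (q n)))"

text \<open>Every point of Baire space is uniquely of the form \<open>join (prepend i r) p\<close>, so the lemma
  \<open>universal_join\<close> below characterizes this function.\<close>

definition universal :: "baire \<Rightarrow> baire option" where
  "universal s =
     (let i = evens s 0; r = (\<lambda>n. evens s (Suc n)); p = odds s; f = phi (join r p) i
      in if \<forall>n. f n \<noteq> None then Some (\<lambda>n. the (f n)) else None)"

lemma universal_join:
  "universal (join (prepend i r) p) =
     (if \<forall>n. phi (join r p) i n \<noteq> None then Some (\<lambda>n. the (phi (join r p) i n)) else None)"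
  by (simp add: universal_def Let_def)


section \<open>Represented spaces, problems and strong Weihrauch reducibility\<close>

text \<open>A represented space is given by its representation; surjectivity of the representation
  means that the underlying set is the range.\<close>

type_synonym 'a represented_space = "baire \<Rightarrow> 'a option"

abbreviation points :: "'a represented_space \<Rightarrow> 'a set" where
  "points \<delta> \<equiv> ran \<delta>"

definition baire_space :: "baire represented_space" where
  "baire_space = Some"

definition seq_space :: "'a represented_space \<Rightarrow> (nat \<Rightarrow> 'a) represented_space" where
  "seq_space \<delta> p =
     (if \<forall>n. component p n \<in> dom \<delta> then Some (\<lambda>n. the (\<delta> (component p n))) else None)"

lemma seq_space_eq_Some_iff: "seq_space \<delta> p = Some x \<longleftrightarrow> (\<forall>n. \<delta> (component p n) = Some (x n))"
proof
  assume "seq_space \<delta> p = Some x"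
  then show "\<forall>n. \<delta> (component p n) = Some (x n)"
    by (auto simp: seq_space_def domIff split: if_splits)
next
  assume "\<forall>n. \<delta> (component p n) = Some (x n)"
  then show "seq_space \<delta> p = Some x" by (simp add: seq_space_def domIff)
qed

lemma points_seq_space:
  fixes \<delta> :: "'a represented_space"
  shows "points (seq_space \<delta>) = {x. \<forall>n. x n \<in> points \<delta>}"
proof (intro set_eqI iffI CollectI)
  fix x :: "nat \<Rightarrow> 'a" assume "x \<in> {x. \<forall>n. x n \<in> points \<delta>}"
  then have "\<forall>n. \<exists>p. \<delta> p = Some (x n)" by (simp add: ran_def)
  then obtain P where "\<And>n. \<delta> (P n) = Some (x n)" by metis
  then have "seq_space \<delta> (tuple P) = Some x" by (simp add: seq_space_eq_Some_iff)
  then show "x \<in> points (seq_space \<delta>)" by (auto simp: ran_def)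
qed (auto simp: ran_def seq_space_eq_Some_iff)

text \<open>A partial multi-valued function is encoded by its sets of values; its domain consists of
  the points with at least one value.\<close>

record ('a, 'b) multifun =
  source :: "'a represented_space"
  target :: "'b represented_space"
  vals :: "'a \<Rightarrow> 'b set"

definition mdom :: "('a, 'b) multifun \<Rightarrow> 'a set" where
  "mdom f = {x. vals f x \<noteq> {}}"

definition realizer :: "(baire \<Rightarrow> baire option) \<Rightarrow> ('a, 'b) multifun \<Rightarrow> bool" where
  "realizer F f \<longleftrightarrow>
     (\<forall>p x. source f p = Some x \<and> x \<in> mdom f \<longrightarrow>
        (\<exists>q y. F p = Some q \<and> target f q = Some y \<and> y \<in> vals f x))"

definition is_problem :: "('a, 'b) multifun \<Rightarrow> bool" where
  "is_problem f \<longleftrightarrow>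
     mdom f \<subseteq> points (source f) \<and> (\<forall>x. vals f x \<subseteq> points (target f)) \<and> (\<exists>F. realizer F f)"

text \<open>Only meaningful for problems; that the multi-valued functions considered here are problems
  is shown at the end.\<close>

definition sW_le :: "('a, 'b) multifun \<Rightarrow> ('c, 'd) multifun \<Rightarrow> bool"
    (infix \<open>\<le>\<^sub>s\<^sub>W\<close> 50) where
  "f \<le>\<^sub>s\<^sub>W g \<longleftrightarrow>
     (\<exists>H K. computable H \<and> computable K \<and>
        (\<forall>G. realizer G g \<longrightarrow> realizer (H \<circ>\<^sub>m G \<circ>\<^sub>m K) f))"

definition sW_equiv :: "('a, 'b) multifun \<Rightarrow> ('c, 'd) multifun \<Rightarrow> bool"
    (infix \<open>\<equiv>\<^sub>s\<^sub>W\<close> 50) where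
  "f \<equiv>\<^sub>s\<^sub>W g \<longleftrightarrow> f \<le>\<^sub>s\<^sub>W g \<and> g \<le>\<^sub>s\<^sub>W f"

definition parallelization ::
    "('a, 'b) multifun \<Rightarrow> (nat \<Rightarrow> 'a, nat \<Rightarrow> 'b) multifun" where
  "parallelization f =
     \<lparr>source = seq_space (source f), target = seq_space (target f),
      vals = (\<lambda>x. {y. \<forall>n. y n \<in> vals f (x n)})\<rparr>"

lemma mdom_parallelization:
  fixes f :: "('a, 'b) multifun"
  shows "mdom (parallelization f) = {x. \<forall>n. x n \<in> mdom f}"
proof (intro set_eqI iffI CollectI)
  fix x :: "nat \<Rightarrow> 'a" assume "x \<in> {x. \<forall>n. x n \<in> mdom f}"
  then have "\<forall>n. \<exists>b. b \<in> vals f (x n)" by (auto simp: mdom_def)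
  then obtain y where "\<And>n. y n \<in> vals f (x n)" by metis
  then show "x \<in> mdom (parallelization f)" by (auto simp: mdom_def parallelization_def)
qed (auto simp: mdom_def parallelization_def)

definition DIS :: "(baire, baire) multifun" where
  "DIS = \<lparr>source = baire_space, target = baire_space, vals = (\<lambda>p. {q. universal p \<noteq> Some q})\<rparr>"

definition NON :: "(baire, baire) multifun" where
  "NON = \<lparr>source = baire_space, target = baire_space, vals = (\<lambda>p. {q. \<not> q \<le>\<^sub>T p})\<rparr>"


section \<open>The multi-valued functions in question are problems\<close>

lemma is_problemI:
  assumes dom: "mdom f \<subseteq> points (source f)" and vals: "\<And>x. vals f x \<subseteq> points (target f)"
  shows "is_problem f"
proof -
  have "\<exists>q. \<forall>x. source f p = Some x \<and> x \<in> mdom f \<longrightarrow>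
      (\<exists>y. target f q = Some y \<and> y \<in> vals f x)" for p
  proof (cases "\<exists>x. source f p = Some x \<and> x \<in> mdom f")
    case True
    then obtain x where x: "source f p = Some x" "x \<in> mdom f" by blast
    then obtain y where "y \<in> vals f x" by (auto simp: mdom_def)
    moreover from this vals obtain q where "target f q = Some y" by (fastforce simp: ran_def)
    ultimately show ?thesis using x by auto
  qed blast
  then obtain F where "\<And>p x. source f p = Some x \<and> x \<in> mdom f \<Longrightarrow>
      \<exists>y. target f (F p) = Some y \<and> y \<in> vals f x"
    by metis
  then have "realizer (\<lambda>p. Some (F p)) f" by (auto simp: realizer_def)
  with assms show ?thesis by (auto simp: is_problem_def)
qed

lemma points_baire_space [simp]: "points baire_space = UNIV"
  by (auto simp: baire_space_def ran_def)

lemma is_problem_parallelization: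
  assumes "is_problem f"
  shows "is_problem (parallelization f)"
proof (rule is_problemI)
  show "mdom (parallelization f) \<subseteq> points (source (parallelization f))"
    using assms unfolding mdom_parallelization
    by (auto simp: is_problem_def parallelization_def points_seq_space)
  show "vals (parallelization f) x \<subseteq> points (target (parallelization f))" for x
    using assms by (auto simp: is_problem_def parallelization_def points_seq_space)
qed

lemma is_problem_DIS: "is_problem DIS"
  by (rule is_problemI) (simp_all add: DIS_def)

lemma mdom_DIS: "mdom DIS = UNIV"
proof -
  have "\<exists>q. universal p \<noteq> Some q" for p
  proof (cases "universal p")
    case (Some r)
    then have "universal p \<noteq> Some (\<lambda>n. Suc (r n))" by (metis n_not_Suc_n option.inject)
    then show ?thesis by blast
  qed simp
  then show ?thesis by (auto simp: mdom_def DIS_def)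
qed

lemma is_problem_NON: "is_problem NON"
  by (rule is_problemI) (simp_all add: NON_def)

lemma mdom_NON: "mdom NON = UNIV"
proof -
  have "\<not> (\<lambda>n. Suc (the (phi p n n))) \<le>\<^sub>T p" for p
    unfolding turing_le_def by (metis n_not_Suc_n option.sel)
  then show ?thesis by (auto simp: mdom_def NON_def)
qed

end

theory Submission
  imports Defs
begin

text \<open>\<open>\<Pi>(DIS) \<le> NON\<close>: if \<open>q \<not>\<le>\<^sub>T p\<close> then \<open>q\<close> differs from every \<open>U(p\<^sub>n)\<close>, as
  these are computable from \<open>p = \<langle>p\<^sub>0, p\<^sub>1, \<dots>\<rangle>\<close> whenever they are defined; so \<open>(q, q, q, \<dots>)\<close>
  is a solution.

  \<open>NON \<le> \<Pi>(DIS)\<close>: since \<open>p = \<langle>r, s\<rangle>\<close> for the even part \<open>r\<close> and the odd part \<open>s\<close> of \<open>p\<close>,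
  we have \<open>U\<langle>\<langle>i, r\<rangle>, s\<rangle> = \<phi>\<^sub>i\<^sup>p\<close>. Let \<open>e(n)\<close> be an index of \<open>k \<mapsto> \<phi>\<^sub>n\<^sup>p\<langle>n, k\<rangle>\<close>. A sequence
  \<open>(q\<^sub>n)\<close> with \<open>q\<^sub>n \<noteq> U\<langle>\<langle>e(n), r\<rangle>, s\<rangle>\<close> for all \<open>n\<close> satisfies \<open>\<langle>q\<^sub>0, q\<^sub>1, \<dots>\<rangle> \<noteq> \<phi>\<^sub>n\<^sup>p\<close>
  for all \<open>n\<close>.\<close>

section \<open>Closure properties of the total functions computable uniformly in the oracle\<close>

definition total_computable :: "(baire \<Rightarrow> nat \<Rightarrow> nat) \<Rightarrow> bool" where
  "total_computable F \<longleftrightarrow> (\<exists>c. \<forall>p x. eval p c x = Some (F p x))"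

named_theorems total_computable_intros

lemma total_computable_zero: "total_computable (\<lambda>p x. 0)"
  unfolding total_computable_def by (rule exI[of _ ZeroP]) simp

lemma total_computable_id [total_computable_intros]: "total_computable (\<lambda>p x. x)"
  unfolding total_computable_def by (rule exI[of _ "PairP LeftP RightP"]) simp

lemma total_computable_compose:
  assumes "total_computable F" "total_computable G"
  shows "total_computable (\<lambda>p x. F p (G p x))"
proof -
  from assms obtain c d where "\<forall>p x. eval p c x = Some (F p x)" "\<forall>p x. eval p d x = Some (G p x)"
    unfolding total_computable_def by blast
  then have "\<forall>p x. eval p (CompP c d) x = Some (F p (G p x))" by simp
  then show ?thesis unfolding total_computable_def by blast
qed

lemma total_computable_Suc [total_computable_intros]:
  assumes "total_computable F"
  shows "total_computable (\<lambda>p x. Suc (F p x))"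
proof -
  have "total_computable (\<lambda>p. Suc)"
    unfolding total_computable_def by (rule exI[of _ SuccP]) simp
  from total_computable_compose[OF this assms] show ?thesis .
qed

lemma total_computable_fst_unpair [total_computable_intros]:
  assumes "total_computable F"
  shows "total_computable (\<lambda>p x. fst (unpair (F p x)))"
proof -
  have "total_computable (\<lambda>p x. fst (unpair x))"
    unfolding total_computable_def by (rule exI[of _ LeftP]) simp
  from total_computable_compose[OF this assms] show ?thesis .
qed

lemma total_computable_snd_unpair [total_computable_intros]:
  assumes "total_computable F"
  shows "total_computable (\<lambda>p x. snd (unpair (F p x)))"
proof -
  have "total_computable (\<lambda>p x. snd (unpair x))"
    unfolding total_computable_def by (rule exI[of _ RightP]) simp
  from total_computable_compose[OF this assms] show ?thesis .
qed

lemma total_computable_oracle [total_computable_intros]: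
  assumes "total_computable F"
  shows "total_computable (\<lambda>p x. p (F p x))"
proof -
  have "total_computable (\<lambda>p. p)"
    unfolding total_computable_def by (rule exI[of _ OracleP]) simp
  from total_computable_compose[OF this assms] show ?thesis .
qed

lemma total_computable_pair [total_computable_intros]:
  assumes "total_computable F" "total_computable G"
  shows "total_computable (\<lambda>p x. pair (F p x) (G p x))"
proof -
  from assms obtain c d where "\<forall>p x. eval p c x = Some (F p x)" "\<forall>p x. eval p d x = Some (G p x)"
    unfolding total_computable_def by blast
  then have "\<forall>p x. eval p (PairP c d) x = Some (pair (F p x) (G p x))" by simp
  then show ?thesis unfolding total_computable_def by blast
qed

lemma total_computable_const [total_computable_intros]: "total_computable (\<lambda>p x. n)"
  by (induction n) (auto intro: total_computable_zero total_computable_Suc)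

lemma total_computable_rec:
  assumes F: "total_computable F" and G: "total_computable G" and B: "total_computable B"
  shows "total_computable (\<lambda>p x. rec_nat (F p x) (\<lambda>n v. G p (pair x (pair n v))) (B p x))"
proof -
  from F G obtain c d where cd: "\<And>p x. eval p c x = Some (F p x)" "\<And>p x. eval p d x = Some (G p x)"
    unfolding total_computable_def by blast
  have "eval p (RecP c d) (pair x y) = Some (rec_nat (F p x) (\<lambda>n v. G p (pair x (pair n v))) y)"
    for p x y
    by (induction y) (simp_all add: cd)
  then have "eval p (RecP c d) z = Some (rec_nat (F p (fst (unpair z)))
      (\<lambda>n v. G p (pair (fst (unpair z)) (pair n v))) (snd (unpair z)))" for p z
    by (metis pair_unpair)
  then have "total_computable (\<lambda>p z. rec_nat (F p (fst (unpair z)))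
      (\<lambda>n v. G p (pair (fst (unpair z)) (pair n v))) (snd (unpair z)))"
    unfolding total_computable_def by blast
  \<comment> \<open>\<open>RecP\<close> takes parameter and recursion depth as one pair, so a
    computed depth is supplied by first forming \<open>pair x (B p x)\<close>.\<close>
  from total_computable_compose[OF this total_computable_pair[OF total_computable_id B]]
  show ?thesis by simp
qed

text \<open>A case distinction is a recursion of depth \<open>B p x\<close> whose step ignores
  counter and previous value: the base is returned at depth 0, the step value at every positive
  depth.\<close>

lemma total_computable_if_zero [total_computable_intros]:
  assumes "total_computable B" "total_computable F" "total_computable G"
  shows "total_computable (\<lambda>p x. if B p x = 0 then F p x else G p x)"
proof -
  have "total_computable (\<lambda>p z. G p (fst (unpair z)))"
    by (intro total_computable_compose[OF assms(3)] total_computable_intros)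
  from total_computable_rec[OF assms(2) this assms(1)]
  have "total_computable (\<lambda>p x. rec_nat (F p x) (\<lambda>n v. G p x) (B p x))" by simp
  moreover have "rec_nat a (\<lambda>n v. b) m = (if m = 0 then a else b)" for a b m :: nat
    by (cases m) auto
  ultimately show ?thesis by simp
qed

lemma total_computable_add [total_computable_intros]:
  assumes "total_computable F" "total_computable G"
  shows "total_computable (\<lambda>p x. F p x + G p x)"
proof -
  have "total_computable (\<lambda>p z. Suc (snd (unpair (snd (unpair z)))))"
    by (intro total_computable_intros)
  from total_computable_rec[OF assms(1) this assms(2)]
  have "total_computable (\<lambda>p x. rec_nat (F p x) (\<lambda>n. Suc) (G p x))" by simp
  moreover have "rec_nat a (\<lambda>n. Suc) m = a + m" for a m by (induction m) auto
  ultimately show ?thesis by simp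
qed

lemma total_computable_pred:
  assumes "total_computable F"
  shows "total_computable (\<lambda>p x. F p x - 1)"
proof -
  \<comment> \<open>The step receives \<open>pair x (pair n v)\<close> and returns the counter
    \<open>n\<close>, which is one less than the depth reached.\<close>
  have "total_computable (\<lambda>p z. fst (unpair (snd (unpair z))))"
    by (intro total_computable_intros)
  from total_computable_rec[OF total_computable_zero this assms]
  have "total_computable (\<lambda>p x. rec_nat 0 (\<lambda>n v. n) (F p x))" by simp
  moreover have "rec_nat 0 (\<lambda>n v. n) m = m - 1" for m by (cases m) auto
  ultimately show ?thesis by simp
qed

lemma total_computable_mod_2 [total_computable_intros]:
  assumes "total_computable F"
  shows "total_computable (\<lambda>p x. F p x mod 2)"
proof -
  have "total_computable (\<lambda>p z. if snd (unpair (snd (unpair z))) = 0 then 1 else 0)"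
    by (intro total_computable_intros)
  from total_computable_rec[OF total_computable_zero this assms]
  have "total_computable (\<lambda>p x. rec_nat 0 (\<lambda>n v. if v = 0 then 1 else 0) (F p x))" by simp
  moreover have "rec_nat 0 (\<lambda>n v. if v = 0 then 1 else 0) m = m mod 2" for m
    by (induction m) (auto simp: mod_Suc)
  ultimately show ?thesis by simp
qed

text \<open>Uniformity is essential here: a single program must serve all oracles.\<close>

lemma total_computable_imp_computable:
  assumes "total_computable F"
  shows "computable (\<lambda>p. Some (F p))"
  using assms unfolding computable_def total_computable_def by (metis option.sel phi_godel)

lemma total_computable_imp_turing_le: "total_computable F \<Longrightarrow> F p \<le>\<^sub>T p"
  unfolding turing_le_def total_computable_def by (metis phi_godel)

section \<open>Oracle substitution and transitivity of Turing reducibility\<close>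

primrec subst_oracle :: "prog \<Rightarrow> prog \<Rightarrow> prog" where
  "subst_oracle d ZeroP = ZeroP"
| "subst_oracle d SuccP = SuccP"
| "subst_oracle d LeftP = LeftP"
| "subst_oracle d RightP = RightP"
| "subst_oracle d OracleP = d"
| "subst_oracle d (PairP a b) = PairP (subst_oracle d a) (subst_oracle d b)"
| "subst_oracle d (CompP a b) = CompP (subst_oracle d a) (subst_oracle d b)"
| "subst_oracle d (RecP a b) = RecP (subst_oracle d a) (subst_oracle d b)"
| "subst_oracle d (MinP a) = MinP (subst_oracle d a)"

text \<open>Each query is answered by running \<open>d\<close>, which always halts with the answer
  of \<open>g\<close>; hence both computations agree, also where they diverge.\<close>

lemma eval_subst_oracle:
  assumes "\<And>n. eval p d n = Some (g n)"
  shows "eval p (subst_oracle d c) = eval g c"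
  by (induction c) (simp_all add: assms)

lemma turing_le_trans:
  assumes "q \<le>\<^sub>T g" "g \<le>\<^sub>T p"
  shows "q \<le>\<^sub>T p"
proof -
  obtain i j where "\<forall>n. phi g i n = Some (q n)" "\<forall>n. phi p j n = Some (g n)"
    using assms unfolding turing_le_def by blast
  then have "\<forall>n. phi p (godel (subst_oracle (inv godel j) (inv godel i))) n = Some (q n)"
    by (simp add: phi_def eval_subst_oracle inv_f_f[OF inj_godel])
  then show ?thesis unfolding turing_le_def by blast
qed

section \<open>The reduction of the parallelized discontinuity problem to non-computability\<close>

lemma universal_turing_le_component:
  assumes "universal (component p n) = Some q"
  shows "q \<le>\<^sub>T p"
proof -
  define s where "s = component p n"
  \<comment> \<open>\<open>F p\<close> is the oracle that \<open>universal\<close> uses on input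
    \<open>s\<close>: removing the index at position 0 moves the even positions by two and leaves
    the odd ones in place.\<close>
  define F where "F = (\<lambda>(p :: baire) m. p (pair n (if m mod 2 = 0 then m + 2 else m)))"
  have "join (\<lambda>m. evens s (Suc m)) (odds s) m = F p m" for m
    by (cases "even m") (auto simp: join_def evens_def odds_def F_def s_def component_def
      mod_2_eq_odd)
  then have "join (\<lambda>m. evens s (Suc m)) (odds s) = F p" by blast
  then have "q \<le>\<^sub>T F p"
    using assms unfolding s_def[symmetric] universal_def Let_def turing_le_def
    by (auto split: if_splits)
  moreover have "F p \<le>\<^sub>T p"
    unfolding F_def by (intro total_computable_imp_turing_le total_computable_intros)
  ultimately show ?thesis by (rule turing_le_trans)
qed

lemma computable_Some: "computable Some"
  using total_computable_imp_computable[of "\<lambda>p. p"] total_computable_oracle[OF total_computable_id]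
  by simp

lemma parallelization_DIS_sW_le_NON: "parallelization DIS \<le>\<^sub>s\<^sub>W NON"
  unfolding sW_le_def
proof (intro exI conjI allI impI)
  let ?H = "\<lambda>q. Some (\<lambda>m. q (snd (unpair m)))"
  show "computable ?H"
    by (intro total_computable_imp_computable total_computable_intros)
  \<comment> \<open>The name of the sequence of instances is itself the instance of
    \<open>NON\<close>.\<close>
  show "computable Some" by (rule computable_Some)
  fix G assume G: "realizer G NON"
  show "realizer (?H \<circ>\<^sub>m G \<circ>\<^sub>m Some) (parallelization DIS)"
    unfolding realizer_def
  proof (intro allI impI)
    fix p x assume "source (parallelization DIS) p = Some x \<and> x \<in> mdom (parallelization DIS)"
    then have x: "x = component p"
      by (auto simp: parallelization_def DIS_def baire_space_def seq_space_eq_Some_iff)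
    obtain q where q: "G p = Some q" "\<not> q \<le>\<^sub>T p"
      using G unfolding realizer_def by (auto simp: mdom_NON) (auto simp: NON_def baire_space_def)
    have "(\<lambda>m. q (snd (unpair m))) = tuple (\<lambda>n. q)" by (simp add: tuple_def fun_eq_iff)
    moreover have "universal (component p n) \<noteq> Some q" for n
      using q(2) universal_turing_le_component by blast
    ultimately show "\<exists>r y. (?H \<circ>\<^sub>m G \<circ>\<^sub>m Some) p = Some r \<and>
        target (parallelization DIS) r = Some y \<and> y \<in> vals (parallelization DIS) x"
      using q(1) x
      by (intro exI[of _ "tuple (\<lambda>n. q)"] exI[of _ "\<lambda>n. q"])
        (simp add: map_comp_def parallelization_def DIS_def baire_space_def seq_space_eq_Some_iff)
  qed
qed

section \<open>Diagonalization: the reduction of non-computability to parallelized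
  discontinuity\<close>

primrec const_prog :: "nat \<Rightarrow> prog" where
  "const_prog 0 = ZeroP"
| "const_prog (Suc n) = CompP SuccP (const_prog n)"

lemma eval_const_prog [simp]: "eval p (const_prog n) x = Some n"
  by (induction n) simp_all

text \<open>An explicit s-m-n index for fixing the first argument of program \<open>n\<close> to
  \<open>n\<close>; \<open>PairP LeftP RightP\<close> is the identity program.\<close>

definition diag_index :: "nat \<Rightarrow> nat" where
  "diag_index n = godel (CompP (inv godel n) (PairP (const_prog n) (PairP LeftP RightP)))"

lemma phi_diag_index: "phi p (diag_index n) k = phi p n (pair n k)"
  unfolding diag_index_def phi_godel by (simp add: phi_def)

lemma total_computable_diag_index:
  assumes "total_computable F"
  shows "total_computable (\<lambda>p x. diag_index (F p x))"
proof -
  \<comment> \<open>The Goedel number of \<open>const_prog n\<close> by recursion: 6 and the factor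
    4 encode \<open>CompP\<close>, and 1 is the code of \<open>SuccP\<close>. The factor 4 is
    spelled out by additions, for which closure is available.\<close>
  let ?g = "\<lambda>n::nat. rec_nat 0 (\<lambda>n v. 6 + (pair 1 v + pair 1 v + (pair 1 v + pair 1 v))) n"
  have "total_computable (\<lambda>p z. let v = snd (unpair (snd (unpair z))) in
      6 + (pair 1 v + pair 1 v + (pair 1 v + pair 1 v)))"
    unfolding Let_def by (intro total_computable_intros)
  from total_computable_rec[OF total_computable_zero this total_computable_id]
  have g: "total_computable (\<lambda>p. ?g)" by (simp add: Let_def)
  have godel_const: "godel (const_prog n) = ?g n" for n by (induction n) simp_all
  have quadruple: "4 * a = a + a + (a + a)" for a :: nat by simp
  \<comment> \<open>Here 5 belongs to \<open>PairP\<close>, while 2 and 3 are the codes of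
    \<open>LeftP\<close> and \<open>RightP\<close>.\<close>
  have "diag_index n = 6 + 4 * pair n (5 + 4 * pair (?g n) (5 + 4 * pair 2 3))" for n
    using surj_f_inv_f[OF surj_godel, of n] by (simp add: diag_index_def godel_const)
  then have "diag_index = (\<lambda>n. 6 + 4 * pair n (5 + 4 * pair (?g n) (5 + 4 * pair 2 3)))"
    by blast
  moreover have "total_computable (\<lambda>p n. 6 + 4 * pair n (5 + 4 * pair (?g n) (5 + 4 * pair 2 3)))"
    unfolding quadruple by (intro total_computable_intros g)
  ultimately have "total_computable (\<lambda>p. diag_index)" by simp
  from total_computable_compose[OF this assms] show ?thesis .
qed

lemma NON_sW_le_parallelization_DIS: "NON \<le>\<^sub>s\<^sub>W parallelization DIS"
  unfolding sW_le_def
proof (intro exI conjI allI impI)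
  define S where "S p n = join (prepend (diag_index n) (evens p)) (odds p)" for p n
  let ?K = "\<lambda>p. Some (tuple (S p))"
  show "computable Some" by (rule computable_Some)
  have universal_S: "universal (S p n) = Some q" if "\<And>k. phi p n (pair n k) = Some (q k)" for p n q
    by (simp add: S_def universal_join phi_diag_index that)
  \<comment> \<open>Prepending the index moves the even part of \<open>p\<close> up by two
    positions, so an even \<open>k > 0\<close> reads \<open>p (k - 2)\<close>; the subtraction is
    written as two predecessors to match \<open>total_computable_pred\<close>.\<close>
  have "tuple (S p) m = (let n = fst (unpair m); k = snd (unpair m) in
      if k = 0 then diag_index n else p (if k mod 2 = 0 then k - 1 - 1 else k))" for p m
  proof (cases "snd (unpair m)")
    case 0
    then show ?thesis by (simp add: tuple_def S_def Let_def join_def)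
  next
    case (Suc j)
    then show ?thesis
      by (cases "even j") (auto simp: tuple_def S_def Let_def join_def evens_def odds_def prepend_def
        mod_2_eq_odd elim!: evenE oddE)
  qed
  then have "(\<lambda>p. tuple (S p)) = (\<lambda>p m. let n = fst (unpair m); k = snd (unpair m) in
      if k = 0 then diag_index n else p (if k mod 2 = 0 then k - 1 - 1 else k))" by blast
  then have "total_computable (\<lambda>p. tuple (S p))"
    by (simp only: Let_def)
      (intro total_computable_intros total_computable_diag_index total_computable_pred)
  then show "computable ?K" by (rule total_computable_imp_computable)
  fix G assume G: "realizer G (parallelization DIS)"
  show "realizer (Some \<circ>\<^sub>m G \<circ>\<^sub>m ?K) NON"
    unfolding realizer_def
  proof (intro allI impI)
    fix p x assume "source NON p = Some x \<and> x \<in> mdom NON"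
    then have x: "x = p" by (simp add: NON_def baire_space_def)
    have "source (parallelization DIS) (tuple (S p)) = Some (S p)"
      by (simp add: parallelization_def DIS_def baire_space_def seq_space_eq_Some_iff)
    moreover have "S p \<in> mdom (parallelization DIS)"
      by (simp add: mdom_parallelization mdom_DIS)
    ultimately obtain q y where "G (tuple (S p)) = Some q"
      "target (parallelization DIS) q = Some y" "y \<in> vals (parallelization DIS) (S p)"
      using G unfolding realizer_def by blast
    then have q: "G (tuple (S p)) = Some q" "\<And>n. universal (S p n) \<noteq> Some (component q n)"
      by (auto simp: parallelization_def DIS_def baire_space_def seq_space_eq_Some_iff)
    have "\<not> q \<le>\<^sub>T p"
    proof
      assume "q \<le>\<^sub>T p"
      then obtain i where "\<And>n. phi p i n = Some (q n)" unfolding turing_le_def by blast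
      \<comment> \<open>The diagonal step: an index \<open>i\<close> computing \<open>q\<close> from
        \<open>p\<close> makes component \<open>i\<close> of \<open>q\<close> exactly the value that
        it has to avoid.\<close>
      then have "universal (S p i) = Some (component q i)"
        by (intro universal_S) (simp add: component_def)
      with q(2) show False by blast
    qed
    with q(1) x show "\<exists>r y. (Some \<circ>\<^sub>m G \<circ>\<^sub>m ?K) p = Some r \<and>
        target NON r = Some y \<and> y \<in> vals NON x"
      by (simp add: map_comp_def NON_def baire_space_def)
  qed
qed

theorem theorem1p11:
  shows "NON \<equiv>\<^sub>s\<^sub>W parallelization DIS"
  using NON_sW_le_parallelization_DIS parallelization_DIS_sW_le_NON by (simp add: sW_equiv_def)

end
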